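(* For $0<p<1$ constant, let $\rho=p^2+(1-p)^2$. Then asymptotically almost surely (as $n\to\infty$) $$(1+o(1))\log_2 n\le\zeta(T(n,p))\le(2+o(1))\frac{\log n}{\log(1/\rho)}.$$ In particular, for almost all tournaments $G$ of order $n$ (that is, for a proportion tending to $1$ as $n\to\infty$ of all tournaments on $[n]$), $$(1+o(1))\log_2 n\le\zeta(G)\le(2+o(1))\log_2 n.$$
   Context: $T(n,p)$ is the random tournament on $[n]=\{1,\ldots,n\}$ in which, independently for each pair $i<j$, the arc between $i$ and $j$ is $(i,j)$ with probability $p$ and $(j,i)$ with probability $1-p$. "Asymptotically almost surely" means with probability tending to $1$ as $n\to\infty$. $\log$ is the natural logarithm. $d(u,v)$ is the length of a shortest directed path from $u$ to $v$, and $d(u,v)=\infty$ if there is no such path. The Localization game with $k$ cops on a digraph $G$: an invisible robber first chooses a vertex; in each round the cops choose vertices $u_1,\dots,u_k$ (any vertices, chosen afresh each round) and learn the distance vector $(d(u_1,x),\ldots,d(u_k,x))$, where $x$ is the robber's current vertex; then the robber stays at $x$ or moves along an arc $(x,y)$ to an out-neighbor $y$. The cops win if they have a strategy which, whatever the robber does, after finitely many rounds determines a unique possible vertex for the robber right after a probe (using all information received so far); otherwise the robber wins. The localization number $\zeta(G)$ is the least positive integer $k$ for which $k$ cops have a winning strategy. *)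

theory Defs
  imports "HOL-Probability.Probability" "Graph_Theory.Graph_Theory"
begin

definition distance :: "'a pair_pre_digraph \<Rightarrow> 'a \<Rightarrow> 'a \<Rightarrow> enat" where
  "distance G u v = (INF q \<in> {q. pre_digraph.apath (with_proj G) u q v}. enat (length q))"

text \<open>
  The cops' strategy maps the distance vectors observed so far (oldest first) to the next
  \<open>k\<close> probed vertices. Since a strategy is deterministic, the earlier probes can be recomputed
  from the observations, and the robber's behaviour, adaptive or not, amounts to the
  trajectory \<open>x\<close> he follows: \<open>x t\<close> is his position during the probe of round \<open>t\<close>.
\<close>

type_synonym 'a cop_strategy = "enat list list \<Rightarrow> 'a list"

definition cop_strategy :: "'a pair_pre_digraph \<Rightarrow> nat \<Rightarrow> 'a cop_strategy \<Rightarrow> bool" where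
  "cop_strategy G k \<sigma> \<longleftrightarrow> (\<forall>h. length (\<sigma> h) = k \<and> set (\<sigma> h) \<subseteq> pverts G)"

definition robber_trajectory :: "'a pair_pre_digraph \<Rightarrow> (nat \<Rightarrow> 'a) \<Rightarrow> bool" where
  "robber_trajectory G x \<longleftrightarrow>
     x 0 \<in> pverts G \<and> (\<forall>t. x (Suc t) = x t \<or> (x t, x (Suc t)) \<in> parcs G)"

primrec observations ::
    "'a pair_pre_digraph \<Rightarrow> 'a cop_strategy \<Rightarrow> (nat \<Rightarrow> 'a) \<Rightarrow> nat \<Rightarrow> enat list list" where
  "observations G \<sigma> x 0 = []"
| "observations G \<sigma> x (Suc t) =
     observations G \<sigma> x t @ [map (\<lambda>u. distance G u (x t)) (\<sigma> (observations G \<sigma> x t))]"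

text \<open>
  The vertices the robber may occupy right after the probe of round \<open>t\<close>, given everything
  the cops have learnt in the rounds \<open>0, \<dots>, t\<close>.
\<close>

definition possible_positions ::
    "'a pair_pre_digraph \<Rightarrow> 'a cop_strategy \<Rightarrow> (nat \<Rightarrow> 'a) \<Rightarrow> nat \<Rightarrow> 'a set" where
  "possible_positions G \<sigma> x t =
     {y t | y. robber_trajectory G y \<and>
               observations G \<sigma> y (Suc t) = observations G \<sigma> x (Suc t)}"

definition winning_cop_strategy :: "'a pair_pre_digraph \<Rightarrow> 'a cop_strategy \<Rightarrow> bool" where
  "winning_cop_strategy G \<sigma> \<longleftrightarrow>
     (\<forall>x. robber_trajectory G x \<longrightarrow> (\<exists>t v. possible_positions G \<sigma> x t = {v}))"

definition cops_win :: "'a pair_pre_digraph \<Rightarrow> nat \<Rightarrow> bool" where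
  "cops_win G k \<longleftrightarrow> (\<exists>\<sigma>. cop_strategy G k \<sigma> \<and> winning_cop_strategy G \<sigma>)"

definition localization_number :: "'a pair_pre_digraph \<Rightarrow> nat" where
  "localization_number G = (LEAST k. 0 < k \<and> cops_win G k)"

definition tournament :: "'a pair_pre_digraph \<Rightarrow> bool" where
  "tournament G \<longleftrightarrow> pair_loopfree_digraph G \<and>
     (\<forall>u \<in> pverts G. \<forall>v \<in> pverts G. u \<noteq> v \<longrightarrow> ((u, v) \<in> parcs G \<longleftrightarrow> (v, u) \<notin> parcs G))"

definition tournaments :: "nat \<Rightarrow> nat pair_pre_digraph set" where
  "tournaments n = {G. pverts G = {1..n} \<and> tournament G}"

definition ordered_pairs :: "nat \<Rightarrow> (nat \<times> nat) set" where
  "ordered_pairs n = {(i, j). 1 \<le> i \<and> i < j \<and> j \<le> n}"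

definition tournament_of :: "nat \<Rightarrow> (nat \<times> nat \<Rightarrow> bool) \<Rightarrow> nat pair_pre_digraph" where
  "tournament_of n b =
     \<lparr>pverts = {1..n},
      parcs = {(i, j) | i j. (i, j) \<in> ordered_pairs n \<and> b (i, j)} \<union>
              {(j, i) | i j. (i, j) \<in> ordered_pairs n \<and> \<not> b (i, j)}\<rparr>"

definition random_tournament :: "nat \<Rightarrow> real \<Rightarrow> nat pair_pre_digraph pmf" where
  "random_tournament n p =
     map_pmf (tournament_of n) (Pi_pmf (ordered_pairs n) False (\<lambda>_. bernoulli_pmf p))"

end

theory Submission
  imports Defs "HOL-Real_Asymp.Real_Asymp"
begin

text \<open>
  The cops win with one probe, the robber survives by one step at a time; both only use the
  distances 0, 1 and 2. Write \<open>\<rho> = p\<^sup>2 + (1 - p)\<^sup>2\<close> and \<open>q = (min p (1 - p))\<^sup>2\<close>.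

  For the upper bound the cops probe the vertices \<open>1, \<dots>, k\<close>. A probed robber is at
  distance 0 from himself, so the probe can only fail to separate two vertices \<open>x, y > k\<close>
  whose arcs to all of \<open>1, \<dots>, k\<close> are oriented alike. Each of these \<open>k\<close> independent
  agreements has probability \<open>\<rho>\<close>, so some pair is not separated with probability at most
  \<open>n\<^sup>2 \<rho> ^ k\<close>, and this tends to 0 if \<open>k\<close> slightly exceeds \<open>2 ln n / ln (1 / \<rho>)\<close>
  (\<open>prob_not_separated\<close>, \<open>cops_win_tournament_of\<close>).

  For the lower bound suppose that all distances are at most 2 and all out-degrees exceed
  \<open>k + 2 ^ k\<close>. Whatever \<open>k\<close> vertices are probed next, the out-neighbours of the robber's
  position that are not probed produce at most \<open>2 ^ k\<close> distance vectors, so two of them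
  produce the same one. The robber moves to one of the two, and the cops can never tell it
  from the other (\<open>robber_evades\<close>). The assumption holds with high probability with
  out-degrees at least about \<open>n / (ln n)\<^sup>2\<close>: cut the vertices into blocks of about
  \<open>(ln n)\<^sup>2\<close> vertices; the probability that some two vertices \<open>u, v\<close> have no path
  \<open>u \<rightarrow> w \<rightarrow> v\<close> with \<open>w\<close> in some block is at most \<open>n\<^sup>3 (1 - q) ^ ((ln n)\<^sup>2 - 2)\<close>, which
  tends to 0 (\<open>prob_no_path_through\<close>, \<open>robber_evades_tournament_of\<close>). Since
  \<open>log 2 (n / (ln n)\<^sup>2) = (1 + o(1)) log 2 n\<close>, nothing is lost by so crude a bound on the
  out-degrees.

  For \<open>p = 1 / 2\<close> the random tournament is uniformly distributed and \<open>\<rho> = 1 / 2\<close>, so the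
  statement on almost all tournaments is a special case.
\<close>

section \<open>Small distances\<close>

lemma distance_le_length:
  "pre_digraph.apath (with_proj G) u q v \<Longrightarrow> distance G u v \<le> enat (length q)"
  unfolding distance_def by (rule INF_lower) simp

lemma distance_attained:
  assumes "distance G u v = enat m"
  obtains q where "pre_digraph.apath (with_proj G) u q v" "length q = m"
proof -
  let ?A = "(\<lambda>q. enat (length q)) ` {q. pre_digraph.apath (with_proj G) u q v}"
  have "?A \<noteq> {}"
    using assms by (auto simp: distance_def Inf_enat_def simp del: image_is_empty split: if_splits)
  then have "Inf ?A \<in> ?A"
    unfolding Inf_enat_def by (auto intro: LeastI)
  then show thesis
    using assms that by (auto simp: distance_def)
qed

lemma distance_eq_0_iff:
  assumes "u \<in> pverts G"
  shows "distance G u v = 0 \<longleftrightarrow> u = v"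
proof
  assume "distance G u v = 0"
  then show "u = v"
    by (auto simp: zero_enat_def pre_digraph.apath_def pre_digraph.awalk_def
        pre_digraph.cas.simps elim!: distance_attained)
next
  assume "u = v"
  with assms have "pre_digraph.apath (with_proj G) u [] v"
    by (simp add: pre_digraph.apath_def pre_digraph.awalk_def pre_digraph.cas.simps
        pre_digraph.awalk_verts.simps)
  from distance_le_length[OF this] show "distance G u v = 0"
    by (simp add: zero_enat_def [symmetric])
qed

lemma distance_eq_1_iff:
  assumes "u \<in> pverts G" "u \<noteq> v"
  shows "distance G u v = 1 \<longleftrightarrow> (u, v) \<in> parcs G"
proof
  assume "distance G u v = 1"
  then show "(u, v) \<in> parcs G"
    by (auto simp: one_enat_def pre_digraph.apath_def pre_digraph.awalk_def
        pre_digraph.cas.simps length_Suc_conv elim!: distance_attained)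
next
  assume "(u, v) \<in> parcs G"
  with assms have "pre_digraph.apath (with_proj G) u [(u, v)] v"
    by (simp add: pre_digraph.apath_def pre_digraph.awalk_def pre_digraph.cas.simps
        pre_digraph.awalk_verts.simps)
  from distance_le_length[OF this] have "distance G u v \<le> 1"
    by (simp add: one_enat_def)
  moreover have "distance G u v \<noteq> 0"
    using assms by (simp add: distance_eq_0_iff)
  ultimately show "distance G u v = 1"
    by (cases "distance G u v") (auto simp: one_enat_def zero_enat_def)
qed

lemma distance_le_2:
  assumes "u \<in> pverts G" "(u, w) \<in> parcs G" "(w, v) \<in> parcs G" "distinct [u, w, v]"
  shows "distance G u v \<le> 2"
proof -
  have "pre_digraph.apath (with_proj G) u [(u, w), (w, v)] v"
    using assms by (simp add: pre_digraph.apath_def pre_digraph.awalk_def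
        pre_digraph.cas.simps pre_digraph.awalk_verts.simps)
  from distance_le_length[OF this] show ?thesis
    by (simp add: numeral_eq_enat numeral_2_eq_2)
qed

section \<open>Strategies of the cops and of the robber\<close>

lemma cops_win_if_resolving:
  assumes "set us \<subseteq> pverts G"
    and resolving: "\<And>x y. x \<in> pverts G \<Longrightarrow> y \<in> pverts G \<Longrightarrow> x \<noteq> y \<Longrightarrow>
      \<exists>u \<in> set us. distance G u x \<noteq> distance G u y"
  shows "cops_win G (length us)"
proof -
  let ?\<sigma> = "\<lambda>_ :: enat list list. us"
  have "possible_positions G ?\<sigma> x 0 = {x 0}" if "robber_trajectory G x" for x
  proof -
    have "y 0 = x 0" if "robber_trajectory G y"
      and "map (\<lambda>u. distance G u (y 0)) us = map (\<lambda>u. distance G u (x 0)) us" for y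
      using resolving[of "y 0" "x 0"] that \<open>robber_trajectory G x\<close>
      by (auto simp: robber_trajectory_def)
    then show ?thesis
      using that by (auto simp: possible_positions_def)
  qed
  then have "winning_cop_strategy G ?\<sigma>"
    by (auto simp: winning_cop_strategy_def)
  then show ?thesis
    using assms(1) unfolding cops_win_def by (intro exI[of _ ?\<sigma>]) (simp add: cop_strategy_def)
qed

text \<open>
  The robber at \<open>x\<close> wants a step that leaves the next probe inconclusive: two
  out-neighbours of \<open>x\<close> with the same distance vector. He moves to one of them; the cops cannot
  exclude the other, since it, too, is reached by one arc from the robber's true previous
  position. So keeping track of one alternative trajectory per round, branching off
  at the last step only, is enough, although the set of possible positions may be much larger.
\<close>
lemma robber_evades:
  assumes "pverts G \<noteq> {}"
    and twins: "\<And>x us. x \<in> pverts G \<Longrightarrow> set us \<subseteq> pverts G \<Longrightarrow> length us = k \<Longrightarrow>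
      \<exists>a \<in> pverts G. \<exists>b \<in> pverts G. (x, a) \<in> parcs G \<and> (x, b) \<in> parcs G \<and> a \<noteq> b \<and>
        map (\<lambda>u. distance G u a) us = map (\<lambda>u. distance G u b) us"
  shows "\<not> cops_win G k"
proof
  assume "cops_win G k"
  then obtain \<sigma> where \<sigma>: "\<And>h. length (\<sigma> h) = k" "\<And>h. set (\<sigma> h) \<subseteq> pverts G"
    and win: "winning_cop_strategy G \<sigma>"
    by (auto simp: cops_win_def cop_strategy_def)
  define vec where "vec = (\<lambda>h a. map (\<lambda>u. distance G u a) (\<sigma> h))"
  \<comment> \<open>
    The strategy is deterministic, so the robber knows the next probe before he moves. A state
    consists of the observations before round \<open>t\<close>, his position in that round and the alternative.
  \<close>
  define P where "P = (\<lambda>(t :: nat) (h, a, b). length h = t \<and> a \<in> pverts G \<and> b \<in> pverts G \<and>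
    a \<noteq> b \<and> vec h a = vec h b)"
  define Q where "Q = (\<lambda>(t :: nat) (h, a, b :: 'a) (h', a', b').
    h' = h @ [vec h a] \<and> (a, a') \<in> parcs G \<and> (a, b') \<in> parcs G)"
  have step: "\<exists>a' \<in> pverts G. \<exists>b' \<in> pverts G. (a, a') \<in> parcs G \<and> (a, b') \<in> parcs G \<and> a' \<noteq> b' \<and>
    vec h a' = vec h b'" if "a \<in> pverts G" for h a
    using twins[OF that \<sigma>(2) \<sigma>(1)] by (simp add: vec_def)
  have "\<exists>f. \<forall>t. P t (f t) \<and> Q t (f t) (f (Suc t))"
  proof (rule dependent_nat_choice)
    obtain v where "v \<in> pverts G"
      using assms(1) by blast
    from step[OF this, of "[]"] show "\<exists>s. P 0 s"
      by (auto simp: P_def)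
  next
    fix s t assume "P t s"
    moreover obtain h a b where s: "s = (h, a, b)"
      by (cases s)
    ultimately have "a \<in> pverts G" "length h = t"
      by (auto simp: P_def)
    moreover from this(1) step[of a "h @ [vec h a]"] obtain a' b' where
      "a' \<in> pverts G" "b' \<in> pverts G" "(a, a') \<in> parcs G" "(a, b') \<in> parcs G" "a' \<noteq> b'"
      "vec (h @ [vec h a]) a' = vec (h @ [vec h a]) b'"
      by blast
    ultimately have "P (Suc t) (h @ [vec h a], a', b') \<and> Q t s (h @ [vec h a], a', b')"
      by (simp add: P_def Q_def s)
    then show "\<exists>s'. P (Suc t) s' \<and> Q t s s'" ..
  qed
  then obtain f where f: "\<And>t. P t (f t)" "\<And>t. Q t (f t) (f (Suc t))"
    by blast
  define h x b where "h = (\<lambda>t. fst (f t))" "x = (\<lambda>t. fst (snd (f t)))" "b = (\<lambda>t. snd (snd (f t)))"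
  have f_eq: "f t = (h t, x t, b t)" for t
    by (simp add: h_x_b_def)
  have P: "length (h t) = t" "x t \<in> pverts G" "b t \<in> pverts G" "x t \<noteq> b t"
      "vec (h t) (x t) = vec (h t) (b t)" for t
    using f(1)[of t] by (auto simp: P_def f_eq)
  have Q: "h (Suc t) = h t @ [vec (h t) (x t)]" "(x t, x (Suc t)) \<in> parcs G"
      "(x t, b (Suc t)) \<in> parcs G" for t
    using f(2)[of t] by (auto simp: Q_def f_eq)
  have x: "robber_trajectory G x"
    using P(2) Q(2) by (auto simp: robber_trajectory_def)
  have obs_x: "observations G \<sigma> x t = h t" for t
    by (induction t) (use P(1)[of 0] Q(1) in \<open>auto simp: vec_def\<close>)
  have "\<nexists>v. possible_positions G \<sigma> x t = {v}" for t
  proof -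
    \<comment> \<open>From round \<open>t\<close> on, this trajectory rests at the alternative vertex.\<close>
    define y where "y = (\<lambda>s. if s < t then x s else b t)"
    have y: "robber_trajectory G y"
      unfolding robber_trajectory_def
    proof (intro conjI allI)
      show "y 0 \<in> pverts G"
        by (simp add: y_def P)
      fix s
      consider "Suc s < t" | "Suc s = t" | "t \<le> s"
        by linarith
      then show "y (Suc s) = y s \<or> (y s, y (Suc s)) \<in> parcs G"
        by cases (use Q(2,3) in \<open>auto simp: y_def\<close>)
    qed
    have "observations G \<sigma> y s = observations G \<sigma> x s" if "s \<le> t" for s
      using that by (induction s) (auto simp: y_def)
    then have "observations G \<sigma> y (Suc t) = observations G \<sigma> x (Suc t)"
      using P(5)[of t] by (simp add: obs_x y_def vec_def)
    with y have "b t \<in> possible_positions G \<sigma> x t"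
      by (auto simp: possible_positions_def y_def intro!: exI[of _ y])
    moreover have "x t \<in> possible_positions G \<sigma> x t"
      using x by (auto simp: possible_positions_def)
    ultimately show ?thesis
      using P(4)[of t] by auto
  qed
  with win x show False
    by (auto simp: winning_cop_strategy_def)
qed

text \<open>
  In a digraph of diameter at most 2, a probe shows an unprobed vertex only whether
  it is at distance 1 or 2 from each probed one. Hence \<open>k\<close> probes split the unprobed
  vertices into at most \<open>2 ^ k\<close> classes, and more than \<open>k + 2 ^ k\<close> out-neighbours cannot all be
  told apart.
\<close>
lemma robber_evades_if_diameter_2:
  assumes fin: "finite (pverts G)" and "pverts G \<noteq> {}"
    and diam: "\<And>u v. u \<in> pverts G \<Longrightarrow> v \<in> pverts G \<Longrightarrow> u \<noteq> v \<Longrightarrow> distance G u v \<le> 2"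
    and deg: "\<And>x. x \<in> pverts G \<Longrightarrow> k + 2 ^ k < card {a \<in> pverts G. (x, a) \<in> parcs G}"
  shows "\<not> cops_win G k"
proof (rule robber_evades[OF assms(2)])
  fix x us assume x: "x \<in> pverts G" and us: "set us \<subseteq> pverts G" "length us = k"
  define N where "N = {a \<in> pverts G. (x, a) \<in> parcs G}"
  define vec where "vec = (\<lambda>a. map (\<lambda>u. distance G u a) us)"
  have "distance G u a \<in> {1, 2}" if "u \<in> set us" "a \<in> N - set us" for u a
  proof -
    have "u \<in> pverts G" "a \<in> pverts G" "u \<noteq> a"
      using that us by (auto simp: N_def)
    then have "distance G u a \<le> 2" "distance G u a \<noteq> 0"
      using diam by (auto simp: distance_eq_0_iff)
    then show ?thesis
      by (cases "distance G u a") (auto simp: one_enat_def zero_enat_def numeral_eq_enat)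
  qed
  then have "vec ` (N - set us) \<subseteq> {xs. set xs \<subseteq> {1, 2} \<and> length xs = k}"
    using us by (simp add: vec_def image_subset_iff)
  then have "card (vec ` (N - set us)) \<le> card {xs :: enat list. set xs \<subseteq> {1, 2} \<and> length xs = k}"
    by (intro card_mono finite_lists_length_eq) auto
  also have "\<dots> = 2 ^ k"
    by (subst card_lists_length_eq) (auto simp: numeral_2_eq_2)
  also have "\<dots> < card N - k"
    using deg[OF x] by (simp add: N_def)
  also have "\<dots> \<le> card N - card (set us)"
    using us(2) card_length[of us] by simp
  also have "\<dots> \<le> card (N - set us)"
    by (rule diff_card_le_card_Diff) simp
  finally have "\<not> inj_on vec (N - set us)"
    by (rule pigeonhole)
  then show "\<exists>a \<in> pverts G. \<exists>b \<in> pverts G. (x, a) \<in> parcs G \<and> (x, b) \<in> parcs G \<and> a \<noteq> b \<and>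
      map (\<lambda>u. distance G u a) us = map (\<lambda>u. distance G u b) us"
    by (auto simp: inj_on_def N_def vec_def)
qed

text \<open>
  The lower bound, too, depends on a win of some number of cops: otherwise the set whose
  least element is the localization number could be empty.
\<close>
lemma localization_number_bounds:
  assumes "0 < k" "cops_win G k" and "\<And>j. j \<le> K \<Longrightarrow> \<not> cops_win G j"
  shows "K < localization_number G" "localization_number G \<le> k"
proof -
  have "cops_win G (localization_number G)"
    unfolding localization_number_def using LeastI[of "\<lambda>k. 0 < k \<and> cops_win G k" k] assms by blast
  with assms(3) show "K < localization_number G"
    using not_less by blast
  show "localization_number G \<le> k"
    unfolding localization_number_def using assms by (intro Least_le) blast
qed

section \<open>Tournaments given by bits\<close>

definition edge :: "nat \<Rightarrow> nat \<Rightarrow> nat \<times> nat" where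
  "edge u v = (min u v, max u v)"

text \<open>
  An orientation of the pair \<open>{u, v}\<close> is read off from the single bit at \<open>edge u v\<close>, so that
  events about arcs are events about the values at given coordinates.
\<close>
definition beats :: "(nat \<times> nat \<Rightarrow> bool) \<Rightarrow> nat \<Rightarrow> nat \<Rightarrow> bool" where
  "beats b u v \<longleftrightarrow> b (edge u v) = (u < v)"

lemma edge_eq_iff: "edge a b = edge c d \<longleftrightarrow> a = c \<and> b = d \<or> a = d \<and> b = c"
  by (auto simp: edge_def min_def max_def)

lemma edge_in_ordered_pairs:
  "u \<in> {1..n} \<Longrightarrow> v \<in> {1..n} \<Longrightarrow> u \<noteq> v \<Longrightarrow> edge u v \<in> ordered_pairs n"
  by (auto simp: edge_def ordered_pairs_def min_def max_def)

lemma finite_ordered_pairs: "finite (ordered_pairs n)"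
  by (rule finite_subset[of _ "{1..n} \<times> {1..n}"]) (auto simp: ordered_pairs_def)

lemma pverts_tournament_of: "pverts (tournament_of n b) = {1..n}"
  by (simp add: tournament_of_def)

lemma arc_tournament_of_iff:
  "(u, v) \<in> parcs (tournament_of n b) \<longleftrightarrow> u \<in> {1..n} \<and> v \<in> {1..n} \<and> u \<noteq> v \<and> beats b u v"
  by (auto simp: tournament_of_def beats_def edge_def ordered_pairs_def min_def max_def)

text \<open>
  Only vertices outside the probed set \<open>{1..k}\<close> need to be separated by arcs: a probed vertex
  is the only one at distance 0 from itself.
\<close>
lemma cops_win_tournament_of:
  assumes "k \<le> n"
    and separated: "\<And>x y. x \<in> {k<..n} \<Longrightarrow> y \<in> {k<..n} \<Longrightarrow> x \<noteq> y \<Longrightarrow>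
      \<exists>w \<in> {1..k}. beats b w x \<noteq> beats b w y"
  shows "cops_win (tournament_of n b) k"
proof -
  let ?G = "tournament_of n b"
  have "\<exists>u \<in> set [1..<Suc k]. distance ?G u x \<noteq> distance ?G u y"
    if xy: "x \<in> {1..n}" "y \<in> {1..n}" "x \<noteq> y" for x y
  proof -
    have zero: "distance ?G z z \<noteq> distance ?G z z'" if "z \<noteq> z'" "z \<in> {1..n}" for z z'
      using that distance_eq_0_iff[of z ?G z] distance_eq_0_iff[of z ?G z']
      by (auto simp: pverts_tournament_of)
    consider "x \<le> k" | "y \<le> k" | "k < x" "k < y"
      by linarith
    then show ?thesis
    proof cases
      case 1
      then show ?thesis using xy zero[of x y] by (auto simp del: upt_Suc intro!: bexI[of _ x])
    next
      case 2
      then show ?thesis using xy zero[of y x] by (auto simp del: upt_Suc intro!: bexI[of _ y])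
    next
      case 3
      with xy have "x \<in> {k<..n}" "y \<in> {k<..n}"
        by auto
      from separated[OF this xy(3)]
      obtain w where w: "w \<in> {1..k}" "beats b w x \<noteq> beats b w y"
        by blast
      then have "distance ?G w x \<noteq> distance ?G w y"
        using 3 xy assms(1) distance_eq_1_iff[of w ?G x] distance_eq_1_iff[of w ?G y]
        by (auto simp: pverts_tournament_of arc_tournament_of_iff)
      with w show ?thesis by (intro bexI[of _ w]) (auto simp del: upt_Suc)
    qed
  qed
  then have "cops_win ?G (length [1..<Suc k])"
    using assms(1) by (intro cops_win_if_resolving) (auto simp: pverts_tournament_of simp del: upt_Suc)
  then show ?thesis by (simp del: upt_Suc)
qed

definition block :: "nat \<Rightarrow> nat \<Rightarrow> nat set" where
  "block m j = {j * m <.. Suc j * m}"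

lemma block_subset: "0 < m \<Longrightarrow> j < n div m \<Longrightarrow> block m j \<subseteq> {1..n}"
proof
  fix w assume "0 < m" "j < n div m" "w \<in> block m j"
  then have "Suc j * m \<le> (n div m) * m" "w \<le> Suc j * m" "0 < w"
    by (simp_all add: block_def del: mult_Suc)
  moreover have "(n div m) * m \<le> n"
    by simp
  ultimately show "w \<in> {1..n}"
    unfolding atLeastAtMost_iff by linarith
qed

lemma disjoint_blocks: "w \<in> block m i \<Longrightarrow> w \<in> block m j \<Longrightarrow> i = j"
proof -
  assume w: "w \<in> block m i" "w \<in> block m j"
  then have "i * m < Suc j * m" "j * m < Suc i * m"
    unfolding block_def by auto
  then have "i < Suc j" "j < Suc i"
    using mult_less_cancel2 by blast+
  then show "i = j" by simp
qed

text \<open>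
  Paths through blocks serve both needs of the robber: if each pair \<open>u \<noteq> v\<close> is joined by a path of length two through each complete
  block, then all distances are at most 2, and each vertex has an out-neighbour in each
  block, hence out-degree at least \<open>n div m\<close>.
\<close>
lemma robber_evades_tournament_of:
  assumes "0 < m" and many: "k + 2 ^ k < n div m"
    and paths: "\<And>u v j. u \<in> {1..n} \<Longrightarrow> v \<in> {1..n} \<Longrightarrow> u \<noteq> v \<Longrightarrow> j < n div m \<Longrightarrow>
      \<exists>w \<in> block m j - {u, v}. beats b u w \<and> beats b w v"
  shows "\<not> cops_win (tournament_of n b) k"
proof -
  let ?G = "tournament_of n b"
  have "1 < n div m"
    using many by (metis add_gr_0 less_nat_zero_code linorder_neqE_nat less_one
        one_le_numeral one_le_power order_le_less_trans trans_le_add2)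
  then have n: "2 \<le> n"
    using div_le_dividend[of n m] by linarith
  show ?thesis
  proof (rule robber_evades_if_diameter_2)
    show "finite (pverts ?G)" "pverts ?G \<noteq> {}"
      using n by (auto simp: pverts_tournament_of)
  next
    fix u v assume "u \<in> pverts ?G" "v \<in> pverts ?G" "u \<noteq> v"
    moreover from this paths[of u v 0] \<open>1 < n div m\<close> obtain w where
      "w \<in> block m 0 - {u, v}" "beats b u w" "beats b w v"
      by (auto simp: pverts_tournament_of)
    moreover have "w \<in> {1..n}"
      using block_subset[of m 0 n] \<open>0 < m\<close> \<open>1 < n div m\<close> calculation by auto
    ultimately show "distance ?G u v \<le> 2"
      by (intro distance_le_2[of _ _ w]) (auto simp: pverts_tournament_of arc_tournament_of_iff)
  next
    fix x assume x: "x \<in> pverts ?G"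
    \<comment> \<open>Any vertex other than \<open>x\<close> can be the common end of paths from \<open>x\<close> through all blocks.\<close>
    define v where "v = (if x = 1 then 2 else 1 :: nat)"
    have v: "v \<in> {1..n}" "x \<noteq> v"
      using n by (auto simp: v_def)
    let ?N = "{a \<in> pverts ?G. (x, a) \<in> parcs ?G}"
    have "\<forall>j \<in> {..<n div m}. \<exists>w. w \<in> ?N \<and> w \<in> block m j"
    proof
      fix j assume j: "j \<in> {..<n div m}"
      with paths[of x v j] x v obtain w where "w \<in> block m j - {x, v}" "beats b x w"
        by (auto simp: pverts_tournament_of)
      then show "\<exists>w. w \<in> ?N \<and> w \<in> block m j"
        using block_subset[of m j n] \<open>0 < m\<close> j x
        by (intro exI[of _ w]) (auto simp: pverts_tournament_of arc_tournament_of_iff)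
    qed
    then obtain g where g: "\<And>j. j < n div m \<Longrightarrow> g j \<in> ?N \<and> g j \<in> block m j"
      unfolding bchoice_iff by auto
    have "inj_on g {..<n div m}"
    proof (rule inj_onI)
      fix i j assume "i \<in> {..<n div m}" "j \<in> {..<n div m}" "g i = g j"
      then show "i = j"
        using g[of i] g[of j] disjoint_blocks[of "g i" m i j] by auto
    qed
    moreover have "g ` {..<n div m} \<subseteq> ?N"
      using g by blast
    moreover have "finite ?N"
      by (simp add: pverts_tournament_of)
    ultimately have "card {..<n div m} \<le> card ?N"
      by (rule card_inj_on_le)
    with many show "k + 2 ^ k < card ?N"
      by simp
  qed
qed

section \<open>Probabilities\<close>

text \<open>
  Events that look at disjoint sets of coordinates are independent. Below, an event belongs to
  a vertex \<open>w\<close> and looks at the two arcs that join \<open>w\<close> to a fixed pair of vertices.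
\<close>
lemma prob_all_local_events:
  fixes p :: "'a \<Rightarrow> bool pmf"
  assumes fin: "finite I" "finite W"
    and K: "\<And>w. w \<in> W \<Longrightarrow> K w \<subseteq> I" and disj: "disjoint_family_on K W"
    and loc: "\<And>w f g. w \<in> W \<Longrightarrow> (\<And>i. i \<in> K w \<Longrightarrow> f i = g i) \<Longrightarrow> Q w f = Q w g"
  shows "measure_pmf.prob (Pi_pmf I d p) {f. \<forall>w \<in> W. Q w f} =
    (\<Prod>w\<in>W. measure_pmf.prob (Pi_pmf I d p) {f. Q w f})"
proof (cases "W = {}")
  case False
  let ?M = "Pi_pmf I d p"
  let ?X = "\<lambda>w f. restrict (\<lambda>i. f i) (K w)"
  let ?A = "\<lambda>w. {g \<in> PiE (K w) (\<lambda>_. UNIV). Q w g}"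
  have indep: "prob_space.indep_vars ?M (\<lambda>w. PiM (K w) (\<lambda>_. count_space UNIV)) ?X W"
    by (rule prob_space.indep_vars_restrict[OF prob_space_measure_pmf
        indep_vars_Pi_pmf[OF fin(1)] K disj])
  have sets: "?A w \<in> sets (PiM (K w) (\<lambda>_. count_space (UNIV :: bool set)))" if "w \<in> W" for w
    using finite_subset[OF K fin(1)] that by (subst count_space_PiM_finite) auto
  have pre: "?X w -` ?A w \<inter> space ?M = {f. Q w f}" if "w \<in> W" for w
  proof -
    have "Q w (restrict f (K w)) = Q w f" for f
      using that by (intro loc) auto
    then show ?thesis by auto
  qed
  have "{f. \<forall>w \<in> W. Q w f} = (\<Inter>w\<in>W. ?X w -` ?A w \<inter> space ?M)"
    using pre by (simp add: set_eq_iff)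
  then show ?thesis
    using prob_space.indep_varsD_finite[OF prob_space_measure_pmf indep False fin(2) sets] pre
    by simp
qed simp

lemma prob_two_coordinates:
  fixes p :: "'a \<Rightarrow> bool pmf"
  assumes "finite I" "i \<in> I" "j \<in> I" "i \<noteq> j"
  shows "measure_pmf.prob (Pi_pmf I d p) {f. f i = \<alpha> \<and> f j = \<beta>} = pmf (p i) \<alpha> * pmf (p j) \<beta>"
proof -
  let ?M = "Pi_pmf I d p"
  have one: "measure_pmf.prob ?M {f. f l = c} = pmf (p l) c" if "l \<in> I" for l c
  proof -
    have "measure_pmf.prob ?M {f. f l = c} = measure_pmf.prob (map_pmf (\<lambda>f. f l) ?M) {c}"
      by (simp add: measure_map_pmf vimage_def)
    also have "\<dots> = pmf (p l) c"
      using that assms(1) by (simp add: Pi_pmf_component measure_pmf_single)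
    finally show ?thesis .
  qed
  let ?Q = "\<lambda>l f. f l = (if l = i then \<alpha> else \<beta>)"
  have "{f. f i = \<alpha> \<and> f j = \<beta>} = {f. \<forall>l \<in> {i, j}. ?Q l f}"
    using assms by auto
  also have "measure_pmf.prob ?M \<dots> = (\<Prod>l\<in>{i, j}. measure_pmf.prob ?M {f. ?Q l f})"
    using assms by (intro prob_all_local_events[where K = "\<lambda>l. {l}"])
      (auto simp: disjoint_family_on_def)
  also have "\<dots> = pmf (p i) \<alpha> * pmf (p j) \<beta>"
    using assms one by simp
  finally show ?thesis .
qed

lemma union_bound:
  assumes "finite I" "\<And>i. i \<in> I \<Longrightarrow> measure_pmf.prob M (A i) \<le> c"
  shows "measure_pmf.prob M (\<Union>i\<in>I. A i) \<le> real (card I) * c"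
proof -
  have "measure_pmf.prob M (\<Union>i\<in>I. A i) \<le> (\<Sum>i\<in>I. measure_pmf.prob M (A i))"
    using assms(1) by (intro measure_pmf.finite_measure_subadditive_finite) auto
  also have "\<dots> \<le> real (card I) * c"
    using assms(2) by (rule sum_bounded_above)
  finally show ?thesis .
qed

abbreviation random_bits :: "nat \<Rightarrow> real \<Rightarrow> (nat \<times> nat \<Rightarrow> bool) pmf" where
  "random_bits n p \<equiv> Pi_pmf (ordered_pairs n) False (\<lambda>_. bernoulli_pmf p)"

lemma disjoint_edge_pairs:
  "x \<noteq> y \<Longrightarrow> x \<notin> W \<Longrightarrow> y \<notin> W \<Longrightarrow> disjoint_family_on (\<lambda>w. {edge x w, edge w y}) W"
  by (auto simp: disjoint_family_on_def edge_eq_iff)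

text \<open>
  As \<open>w \<le> k < x, y\<close>, both arcs are directed away from \<open>w\<close> with the same probability \<open>p\<close>; this is
  why the initial segment \<open>{1..k}\<close> is a convenient set to probe.
\<close>
lemma prob_not_separated:
  assumes p: "0 < p" "p < 1" and xy: "x \<in> {k<..n}" "y \<in> {k<..n}" "x \<noteq> y"
  shows "measure_pmf.prob (random_bits n p) {b. \<forall>w \<in> {1..k}. beats b w x = beats b w y} =
    (p\<^sup>2 + (1 - p)\<^sup>2) ^ k"
proof -
  let ?M = "random_bits n p"
  have one: "measure_pmf.prob ?M {b. beats b w x = beats b w y} = p\<^sup>2 + (1 - p)\<^sup>2"
    if w: "w \<in> {1..k}" for w
  proof -
    have e: "edge w x \<in> ordered_pairs n" "edge w y \<in> ordered_pairs n" "edge w x \<noteq> edge w y"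
      using w xy by (auto intro!: edge_in_ordered_pairs simp: edge_eq_iff)
    have "{b. beats b w x = beats b w y} =
        {b. b (edge w x) = True \<and> b (edge w y) = True} \<union>
        {b. b (edge w x) = False \<and> b (edge w y) = False}"
      using w xy by (auto simp: beats_def)
    also have "measure_pmf.prob ?M \<dots> =
        measure_pmf.prob ?M {b. b (edge w x) = True \<and> b (edge w y) = True} +
        measure_pmf.prob ?M {b. b (edge w x) = False \<and> b (edge w y) = False}"
      by (rule measure_pmf.finite_measure_Union) auto
    also have "\<dots> = p\<^sup>2 + (1 - p)\<^sup>2"
      using p by (simp only: prob_two_coordinates[OF finite_ordered_pairs e])
        (simp add: power2_eq_square)
    finally show ?thesis .
  qed
  have "measure_pmf.prob ?M {b. \<forall>w \<in> {1..k}. beats b w x = beats b w y} =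
      (\<Prod>w\<in>{1..k}. measure_pmf.prob ?M {b. beats b w x = beats b w y})"
  proof (rule prob_all_local_events[where K = "\<lambda>w. {edge x w, edge w y}"])
    show "disjoint_family_on (\<lambda>w. {edge x w, edge w y}) {1..k}"
      using xy by (intro disjoint_edge_pairs) auto
    show "{edge x w, edge w y} \<subseteq> ordered_pairs n" if "w \<in> {1..k}" for w
      using that xy by (auto intro!: edge_in_ordered_pairs)
    show "(beats f w x = beats f w y) = (beats g w x = beats g w y)"
      if "\<And>e. e \<in> {edge x w, edge w y} \<Longrightarrow> f e = g e" for w f g
      using that edge_eq_iff[of w x x w] by (simp add: beats_def)
  qed (auto simp: finite_ordered_pairs)
  also have "\<dots> = (p\<^sup>2 + (1 - p)\<^sup>2) ^ k"
    using one by simp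
  finally show ?thesis .
qed

text \<open>
  The order of \<open>u\<close>, \<open>w\<close> and \<open>v\<close> is arbitrary here, so each of the two arcs of the path has
  probability \<open>p\<close> or \<open>1 - p\<close>, whence the minimum.
\<close>
lemma prob_no_path_through:
  assumes p: "0 < p" "p < 1" and uv: "u \<in> {1..n}" "v \<in> {1..n}" "u \<noteq> v"
    and W: "W \<subseteq> {1..n} - {u, v}"
  shows "measure_pmf.prob (random_bits n p) {b. \<forall>w \<in> W. \<not> (beats b u w \<and> beats b w v)} \<le>
    (1 - (min p (1 - p))\<^sup>2) ^ card W"
proof -
  let ?M = "random_bits n p" and ?q = "(min p (1 - p))\<^sup>2"
  have one: "measure_pmf.prob ?M {b. \<not> (beats b u w \<and> beats b w v)} \<le> 1 - ?q"
    if w: "w \<in> W" for w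
  proof -
    have e: "edge u w \<in> ordered_pairs n" "edge w v \<in> ordered_pairs n" "edge u w \<noteq> edge w v"
      using w uv W by (auto intro!: edge_in_ordered_pairs simp: edge_eq_iff)
    have pmf: "min p (1 - p) \<le> pmf (bernoulli_pmf p) c" for c
      using p by (cases c) auto
    have "?q \<le> pmf (bernoulli_pmf p) (u < w) * pmf (bernoulli_pmf p) (w < v)"
      unfolding power2_eq_square using p by (intro mult_mono pmf) auto
    also have "\<dots> = measure_pmf.prob ?M {b. beats b u w \<and> beats b w v}"
      unfolding beats_def by (rule prob_two_coordinates[OF finite_ordered_pairs e, symmetric])
    also have "\<dots> = 1 - measure_pmf.prob ?M {b. \<not> (beats b u w \<and> beats b w v)}"
      by (subst measure_pmf.prob_compl[symmetric]) (auto simp: Compl_eq intro!: arg_cong2[where f = measure])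
    finally show ?thesis by simp
  qed
  have fin: "finite W"
    using W finite_subset by blast
  have "measure_pmf.prob ?M {b. \<forall>w \<in> W. \<not> (beats b u w \<and> beats b w v)} =
      (\<Prod>w\<in>W. measure_pmf.prob ?M {b. \<not> (beats b u w \<and> beats b w v)})"
  proof (rule prob_all_local_events[where K = "\<lambda>w. {edge u w, edge w v}"])
    show "disjoint_family_on (\<lambda>w. {edge u w, edge w v}) W"
      using uv W by (intro disjoint_edge_pairs) auto
    show "{edge u w, edge w v} \<subseteq> ordered_pairs n" if "w \<in> W" for w
      using that uv W by (auto intro!: edge_in_ordered_pairs)
  qed (auto simp: finite_ordered_pairs fin beats_def)
  also have "\<dots> \<le> (\<Prod>w\<in>W. 1 - ?q)"
    using one by (intro prod_mono) auto
  also have "\<dots> = (1 - ?q) ^ card W"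
    by simp
  finally show ?thesis .
qed

text \<open>
  A bound for each \<open>n\<close>, in which the two error terms are the failure probabilities of the
  cops' probe and of the paths through the blocks. The exponent is \<open>m - 2\<close> because a block may
  contain the two end vertices themselves.
\<close>
lemma localization_number_random_tournament:
  assumes p: "0 < p" "p < 1" and k: "0 < k" "k \<le> n" and m: "0 < m" and K: "K + 2 ^ K < n div m"
  shows "1 - (real n ^ 2 * (p\<^sup>2 + (1 - p)\<^sup>2) ^ k +
             real n ^ 3 * (1 - (min p (1 - p))\<^sup>2) ^ (m - 2)) \<le>
    measure_pmf.prob (random_tournament n p)
      {G. K < localization_number G \<and> localization_number G \<le> k}"
proof -
  let ?M = "random_bits n p" and ?q = "(min p (1 - p))\<^sup>2"
  define A where "A = (\<lambda>(x, y). {b. \<forall>w \<in> {1..k}. beats b w x = beats b w y})"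
  define B where "B = (\<lambda>(u, v, j). {b. \<forall>w \<in> block m j - {u, v}. \<not> (beats b u w \<and> beats b w v)})"
  define I where "I = {(x, y). x \<in> {k<..n} \<and> y \<in> {k<..n} \<and> x \<noteq> y}"
  define J where "J = {(u, v, j). u \<in> {1..n} \<and> v \<in> {1..n} \<and> u \<noteq> v \<and> j < n div m}"
  define good where
    "good = {b. K < localization_number (tournament_of n b) \<and>
                localization_number (tournament_of n b) \<le> k}"
  have I: "I \<subseteq> {1..n} \<times> {1..n}" and J: "J \<subseteq> {1..n} \<times> {1..n} \<times> {..<n}"
    using div_le_dividend[of n m] by (auto simp: I_def J_def simp del: div_le_dividend)
  have fin: "finite I" "finite J"
    using finite_subset[OF I] finite_subset[OF J] by auto
  have cards: "card I \<le> n ^ 2" "card J \<le> n ^ 3"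
    using card_mono[OF _ I] card_mono[OF _ J]
    by (auto simp: card_cartesian_product power2_eq_square power3_eq_cube)
  have q: "0 \<le> 1 - ?q" "1 - ?q \<le> 1"
    using p by (auto simp: power_le_one min_def)

  have "UNIV - good \<subseteq> (\<Union>i\<in>I. A i) \<union> (\<Union>i\<in>J. B i)"
  proof
    fix b assume "b \<in> UNIV - good"
    then have bad: "b \<notin> good" by simp
    show "b \<in> (\<Union>i\<in>I. A i) \<union> (\<Union>i\<in>J. B i)"
    proof (rule ccontr)
      assume neg: "b \<notin> (\<Union>i\<in>I. A i) \<union> (\<Union>i\<in>J. B i)"
      have "cops_win (tournament_of n b) k"
      proof (rule cops_win_tournament_of[OF k(2)])
        fix x y assume "x \<in> {k<..n}" "y \<in> {k<..n}" "x \<noteq> y"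
        then have "(x, y) \<in> I"
          by (simp add: I_def)
        with neg show "\<exists>w \<in> {1..k}. beats b w x \<noteq> beats b w y"
          by (force simp: A_def)
      qed
      moreover have "\<not> cops_win (tournament_of n b) i" if "i \<le> K" for i
      proof (rule robber_evades_tournament_of[OF m])
        have "(2 :: nat) ^ i \<le> 2 ^ K"
          using that by simp
        with that K show "i + 2 ^ i < n div m"
          by linarith
      next
        fix u v j assume "u \<in> {1..n}" "v \<in> {1..n}" "u \<noteq> v" "j < n div m"
        then have "(u, v, j) \<in> J"
          by (simp add: J_def)
        with neg show "\<exists>w \<in> block m j - {u, v}. beats b u w \<and> beats b w v"
          by (force simp: B_def)
      qed
      ultimately have "b \<in> good"
        using localization_number_bounds[OF k(1), of "tournament_of n b" K]
        by (simp add: good_def)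
      with bad show False ..
    qed
  qed
  then have "measure_pmf.prob ?M (UNIV - good) \<le>
      measure_pmf.prob ?M ((\<Union>i\<in>I. A i) \<union> (\<Union>i\<in>J. B i))"
    by (intro measure_pmf.finite_measure_mono) auto
  also have "\<dots> \<le> measure_pmf.prob ?M (\<Union>i\<in>I. A i) + measure_pmf.prob ?M (\<Union>i\<in>J. B i)"
    by (rule measure_Un_le) auto
  also have "measure_pmf.prob ?M (\<Union>i\<in>I. A i) \<le> real (card I) * (p\<^sup>2 + (1 - p)\<^sup>2) ^ k"
  proof (rule union_bound[OF fin(1)])
    fix i assume "i \<in> I"
    then obtain x y where "i = (x, y)" "x \<in> {k<..n}" "y \<in> {k<..n}" "x \<noteq> y"
      by (auto simp: I_def)
    then show "measure_pmf.prob ?M (A i) \<le> (p\<^sup>2 + (1 - p)\<^sup>2) ^ k"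
      using prob_not_separated[OF p, of x k n y] by (simp add: A_def)
  qed
  also have "\<dots> \<le> real n ^ 2 * (p\<^sup>2 + (1 - p)\<^sup>2) ^ k"
    using cards(1) by (intro mult_right_mono) (auto simp flip: of_nat_power)
  also have "measure_pmf.prob ?M (\<Union>i\<in>J. B i) \<le> real (card J) * (1 - ?q) ^ (m - 2)"
  proof (rule union_bound[OF fin(2)])
    fix i assume "i \<in> J"
    then obtain u v j where i: "i = (u, v, j)" "u \<in> {1..n}" "v \<in> {1..n}" "u \<noteq> v" "j < n div m"
      by (auto simp: J_def)
    have "measure_pmf.prob ?M (B i) \<le> (1 - ?q) ^ card (block m j - {u, v})"
      unfolding B_def i prod.case using block_subset[OF m i(5)]
      by (intro prob_no_path_through p i) auto
    also have "m - 2 \<le> card (block m j - {u, v})"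
      using diff_card_le_card_Diff[of "{u, v}" "block m j"] i(4) by (simp add: block_def)
    then have "(1 - ?q) ^ card (block m j - {u, v}) \<le> (1 - ?q) ^ (m - 2)"
      using q by (intro power_decreasing) auto
    finally show "measure_pmf.prob ?M (B i) \<le> (1 - ?q) ^ (m - 2)" .
  qed
  also have "real (card J) * (1 - ?q) ^ (m - 2) \<le> real n ^ 3 * (1 - ?q) ^ (m - 2)"
    using cards(2) q by (intro mult_right_mono) (auto simp flip: of_nat_power)
  finally have "measure_pmf.prob ?M (UNIV - good) \<le>
      real n ^ 2 * (p\<^sup>2 + (1 - p)\<^sup>2) ^ k + real n ^ 3 * (1 - ?q) ^ (m - 2)"
    by simp
  moreover have "measure_pmf.prob ?M (UNIV - good) = 1 - measure_pmf.prob ?M good"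
    using measure_pmf.prob_compl[of good ?M] by simp
  moreover have "measure_pmf.prob (random_tournament n p)
      {G. K < localization_number G \<and> localization_number G \<le> k} = measure_pmf.prob ?M good"
    by (simp add: random_tournament_def measure_map_pmf good_def vimage_def)
  ultimately show ?thesis
    by linarith
qed

section \<open>Uniformly random tournaments\<close>

lemma tournament_tournament_of: "tournament (tournament_of n b)"
proof -
  have "pair_loopfree_digraph (tournament_of n b)"
    by unfold_locales (auto simp: arc_tournament_of_iff pverts_tournament_of)
  then show ?thesis
    by (auto simp: tournament_def arc_tournament_of_iff pverts_tournament_of beats_def
        edge_def min.commute max.commute)
qed

lemma bij_betw_tournament_of:
  "bij_betw (tournament_of n) (PiE_dflt (ordered_pairs n) False (\<lambda>_. UNIV)) (tournaments n)"
proof (rule bij_betw_imageI)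
  show "inj_on (tournament_of n) (PiE_dflt (ordered_pairs n) False (\<lambda>_. UNIV))"
  proof (rule inj_onI)
    fix b c assume b: "b \<in> PiE_dflt (ordered_pairs n) False (\<lambda>_. UNIV)"
      and c: "c \<in> PiE_dflt (ordered_pairs n) False (\<lambda>_. UNIV)"
      and eq: "tournament_of n b = tournament_of n c"
    have "b (i, j) = c (i, j)" for i j
    proof (cases "(i, j) \<in> ordered_pairs n")
      case True
      then have "b (i, j) \<longleftrightarrow> (i, j) \<in> parcs (tournament_of n b)"
        and "c (i, j) \<longleftrightarrow> (i, j) \<in> parcs (tournament_of n c)"
        by (auto simp: arc_tournament_of_iff beats_def edge_def ordered_pairs_def)
      with eq show ?thesis by simp
    next
      case False
      with b c show ?thesis by (simp add: PiE_dflt_def)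
    qed
    then show "b = c" by auto
  qed
next
  have "G \<in> tournament_of n ` PiE_dflt (ordered_pairs n) False (\<lambda>_. UNIV)"
    if G: "G \<in> tournaments n" for G
  proof -
    have V: "pverts G = {1..n}" and "tournament G"
      using G by (auto simp: tournaments_def)
    then have G': "pair_loopfree_digraph G"
      by (simp add: tournament_def)
    have one: "(u, v) \<in> parcs G \<longleftrightarrow> (v, u) \<notin> parcs G" if "u \<in> {1..n}" "v \<in> {1..n}" "u \<noteq> v" for u v
      using that \<open>tournament G\<close> unfolding tournament_def V by blast
    define b where "b = (\<lambda>e. e \<in> ordered_pairs n \<and> e \<in> parcs G)"
    have b: "beats b u v \<longleftrightarrow> (u, v) \<in> parcs G" if "u \<in> {1..n}" "v \<in> {1..n}" "u \<noteq> v" for u v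
    proof (cases "u < v")
      case True
      with edge_in_ordered_pairs[OF that] show ?thesis
        by (simp add: beats_def b_def edge_def)
    next
      case False
      then have "beats b u v \<longleftrightarrow> (v, u) \<notin> parcs G"
        using edge_in_ordered_pairs[OF that] by (simp add: beats_def b_def edge_def)
      with one[OF that] show ?thesis by blast
    qed
    have arc: "u \<in> {1..n} \<and> v \<in> {1..n} \<and> u \<noteq> v" if "(u, v) \<in> parcs G" for u v
      using that pair_loopfree_digraph.pair_no_loops[OF G']
        pair_wf_digraph.arc_fst_in_verts[OF pair_loopfree_digraph.axioms(1)[OF G']]
        pair_wf_digraph.arc_snd_in_verts[OF pair_loopfree_digraph.axioms(1)[OF G']] V
      by fastforce
    have "parcs (tournament_of n b) = parcs G"
      using b arc by (auto simp: arc_tournament_of_iff)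
    then have "G = tournament_of n b"
      using V by (simp add: pair_pre_digraph.equality pverts_tournament_of)
    then show ?thesis
      by (intro image_eqI[of _ _ b]) (auto simp: PiE_dflt_def b_def)
  qed
  then show "tournament_of n ` PiE_dflt (ordered_pairs n) False (\<lambda>_. UNIV) = tournaments n"
    by (auto simp: tournaments_def tournament_tournament_of pverts_tournament_of)
qed

lemma prob_random_tournament_half:
  "measure_pmf.prob (random_tournament n (1 / 2)) A =
    real (card {G \<in> tournaments n. G \<in> A}) / real (card (tournaments n))"
proof -
  let ?B = "PiE_dflt (ordered_pairs n) False (\<lambda>_. UNIV :: bool set)"
  have B: "finite ?B" "?B \<noteq> {}"
    by (auto simp: finite_ordered_pairs)
  have "tournaments n = tournament_of n ` ?B"
    using bij_betw_tournament_of by (simp add: bij_betw_def)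
  with B have fin: "finite (tournaments n)" "tournaments n \<noteq> {}"
    by simp_all
  have "random_tournament n (1 / 2) = pmf_of_set (tournaments n)"
    unfolding random_tournament_def bernoulli_pmf_half_conv_pmf_of_set
    by (simp add: Pi_pmf_of_set finite_ordered_pairs
        map_pmf_of_set_bij_betw[OF bij_betw_tournament_of B(2,1)])
  then show ?thesis
    using fin by (simp add: measure_pmf_of_set Int_def)
qed

section \<open>Asymptotics\<close>

lemma localization_number_aas:
  fixes p :: real
  assumes p: "0 < p" "p < 1"
  defines "\<rho> \<equiv> p\<^sup>2 + (1 - p)\<^sup>2"
  shows "\<exists>\<delta> \<epsilon> :: nat \<Rightarrow> real. \<delta> \<longlonglongrightarrow> 0 \<and> \<epsilon> \<longlonglongrightarrow> 0 \<and>
    (\<lambda>n. measure_pmf.prob (random_tournament n p)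
       {G. (1 + \<delta> n) * log 2 (real n) \<le> real (localization_number G) \<and>
           real (localization_number G) \<le> (2 + \<epsilon> n) * (ln (real n) / ln (1 / \<rho>))})
    \<longlonglongrightarrow> 1"
proof -
  define q where "q = (min p (1 - p))\<^sup>2"
  define L where "L = ln (1 / \<rho>)"
  have "\<rho> = 1 - 2 * p * (1 - p)"
    by (simp add: \<rho>_def power2_eq_square algebra_simps)
  moreover have "0 < p * (1 - p)"
    using p by simp
  ultimately have "\<rho> < 1"
    by simp
  moreover have \<rho>: "0 < \<rho>"
    using p by (simp add: \<rho>_def add_pos_nonneg)
  ultimately have L: "0 < L" and \<rho>_exp: "\<rho> = exp (- L)"
    by (auto simp: L_def ln_div)
  have q: "0 < q" "q \<le> 1"
    using p by (auto simp: q_def min_def power_le_one)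

  \<comment> \<open>
    The term \<open>ln (ln n)\<close> in the number \<open>k\<close> of cops makes \<open>n\<^sup>2 \<rho> ^ k\<close> at most \<open>1 / ln n\<close> and is
    negligible against \<open>ln n\<close>. There are \<open>N\<close> blocks, and \<open>K\<close> is the largest number with
    \<open>2 * 2 ^ K \<le> N\<close>, so that \<open>K + 2 ^ K < N\<close>. Finally \<open>\<epsilon>\<close> and \<open>\<delta>\<close> turn the two bounds of the
    theorem into \<open>k\<close> and \<open>log 2 (N / 2) \<le> K + 1\<close>.
  \<close>
  define k where "k = (\<lambda>n :: nat. nat \<lceil>(2 * ln (real n) + ln (ln (real n))) / L\<rceil>)"
  define m where "m = (\<lambda>n :: nat. nat \<lceil>(ln (real n))\<^sup>2\<rceil>)"
  define N where "N = (\<lambda>n. n div m n)"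
  define K where "K = (\<lambda>n. nat \<lfloor>log 2 (real (N n) / 2)\<rfloor>)"
  define \<epsilon> where "\<epsilon> = (\<lambda>n. real (k n) * L / ln (real n) - 2)"
  define \<delta> where "\<delta> = (\<lambda>n. log 2 (real (N n) / 2) / log 2 (real n) - 1)"
  define err where "err = (\<lambda>n. 1 / ln (real n) + real n ^ 3 * exp (- q * ((ln (real n))\<^sup>2 - 2)))"
  let ?P = "\<lambda>n. measure_pmf.prob (random_tournament n p)
       {G. (1 + \<delta> n) * log 2 (real n) \<le> real (localization_number G) \<and>
           real (localization_number G) \<le> (2 + \<epsilon> n) * (ln (real n) / ln (1 / \<rho>))}"

  have k_bounds: "eventually (\<lambda>n. 2 * ln (real n) + ln (ln (real n)) \<le> real (k n) * L \<and>
      real (k n) * L \<le> 2 * ln (real n) + ln (ln (real n)) + L) at_top"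
  proof -
    have "eventually (\<lambda>n. 0 \<le> 2 * ln (real n) + ln (ln (real n))) at_top"
      by real_asymp
    then show ?thesis
    proof eventually_elim
      case (elim n)
      then have "0 \<le> (2 * ln (real n) + ln (ln (real n))) / L"
        using L by simp
      then have "(2 * ln (real n) + ln (ln (real n))) / L \<le> real (k n)"
        "real (k n) \<le> (2 * ln (real n) + ln (ln (real n))) / L + 1"
        unfolding k_def by linarith+
      then show ?case
        using L by (simp add: field_simps)
    qed
  qed
  have m_bounds: "(ln (real n))\<^sup>2 \<le> real (m n)" "real (m n) \<le> (ln (real n))\<^sup>2 + 1" for n
    unfolding m_def using zero_le_power2[of "ln (real n)"] by linarith+
  have N_lower: "eventually (\<lambda>n. real n / ((ln (real n))\<^sup>2 + 1) - 1 \<le> real (N n)) at_top"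
  proof -
    have "eventually (\<lambda>n. 0 < (ln (real n))\<^sup>2) at_top"
      by real_asymp
    then show ?thesis
    proof eventually_elim
      case (elim n)
      then have pos: "0 < real (m n)"
        using m_bounds(1)[of n] by linarith
      have "real n / ((ln (real n))\<^sup>2 + 1) \<le> real n / real (m n)"
        using m_bounds(2)[of n] pos by (intro divide_left_mono) (auto intro!: mult_pos_pos add_nonneg_pos)
      also have "\<dots> \<le> real (N n) + 1"
        unfolding N_def using floor_divide_of_nat_eq[where ?'a = real, of n "m n"] by linarith
      finally show ?case by simp
    qed
  qed

  have "\<epsilon> \<longlonglongrightarrow> 0"
  proof (rule tendsto_sandwich)
    show "(\<lambda>n. (2 * ln (real n) + ln (ln (real n))) / ln (real n) - 2) \<longlonglongrightarrow> 0"
      by real_asymp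
    show "(\<lambda>n. (2 * ln (real n) + ln (ln (real n)) + L) / ln (real n) - 2) \<longlonglongrightarrow> 0"
      by real_asymp
    have pos: "eventually (\<lambda>n. 0 < ln (real n)) at_top"
      by real_asymp
    from k_bounds pos
    show "eventually (\<lambda>n. (2 * ln (real n) + ln (ln (real n))) / ln (real n) - 2 \<le> \<epsilon> n) at_top"
      by eventually_elim (simp add: \<epsilon>_def divide_right_mono)
    from k_bounds pos
    show "eventually (\<lambda>n. \<epsilon> n \<le> (2 * ln (real n) + ln (ln (real n)) + L) / ln (real n) - 2) at_top"
      by eventually_elim (simp add: \<epsilon>_def divide_right_mono)
  qed
  moreover have "\<delta> \<longlonglongrightarrow> 0"
  proof (rule tendsto_sandwich)
    let ?l = "\<lambda>n. real n / ((ln (real n))\<^sup>2 + 1) - 1"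
    show "(\<lambda>n. log 2 (?l n / 2) / log 2 (real n) - 1) \<longlonglongrightarrow> 0"
      by real_asymp
    show "(\<lambda>n :: nat. 0 :: real) \<longlonglongrightarrow> 0"
      by simp
    have large: "eventually (\<lambda>n. 0 < ?l n) at_top" "eventually (\<lambda>n. 1 < real n) at_top"
      by real_asymp+
    from large N_lower show "eventually (\<lambda>n. log 2 (?l n / 2) / log 2 (real n) - 1 \<le> \<delta> n) at_top"
    proof eventually_elim
      case (elim n)
      have "log 2 (?l n / 2) \<le> log 2 (real (N n) / 2)"
      proof (rule log_mono)
        show "0 < ?l n / 2"
          using elim(1) by (rule half_gt_zero)
        show "?l n / 2 \<le> real (N n) / 2"
          using elim(3) by (rule divide_right_mono) simp
      qed simp
      with elim show ?case
        by (simp add: \<delta>_def divide_right_mono)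
    qed
    from large N_lower show "eventually (\<lambda>n. \<delta> n \<le> 0) at_top"
    proof eventually_elim
      case (elim n)
      then have "0 < real (N n)" by linarith
      moreover have "real (N n) / 2 \<le> real n"
        using div_le_dividend[of n "m n"] unfolding N_def by linarith
      ultimately have "log 2 (real (N n) / 2) \<le> log 2 (real n)"
        by simp
      with elim show ?case
        by (simp add: \<delta>_def)
    qed
  qed
  moreover have "?P \<longlonglongrightarrow> 1"
  proof (rule tendsto_sandwich)
    show "(\<lambda>n. 1 - err n) \<longlonglongrightarrow> 1"
      unfolding err_def using q by real_asymp
    show "(\<lambda>n :: nat. 1 :: real) \<longlonglongrightarrow> 1"
      by simp
    show "eventually (\<lambda>n. ?P n \<le> 1) at_top"
      by simp
    have large: "eventually (\<lambda>n. 1 < ln (real n)) at_top"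
      "eventually (\<lambda>n. 2 * ln (real n) + ln (ln (real n)) + L \<le> real n * L) at_top"
      "eventually (\<lambda>n. 2 \<le> real n / ((ln (real n))\<^sup>2 + 1) - 1) at_top"
      using L by real_asymp+
    from large k_bounds N_lower show "eventually (\<lambda>n. 1 - err n \<le> ?P n) at_top"
    proof eventually_elim
      case (elim n)
      have ln_pos: "0 < ln (real n)" and n_pos: "0 < real n"
        using elim(1) by (auto intro: gr0I)
      have "0 < real (k n) * L"
        using elim ln_pos ln_gt_zero[OF elim(1)] by linarith
      then have k: "0 < k n"
        using L by (simp add: zero_less_mult_iff)
      have "real (k n) * L \<le> real n * L"
        using elim by linarith
      then have k_le: "k n \<le> n"
        using L by simp
      have "1 < (ln (real n))\<^sup>2"
        using elim(1) by simp
      then have m: "0 < m n"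
        using m_bounds(1)[of n] by linarith
      have N2: "2 \<le> real (N n)"
        using elim by linarith
      then have log_nonneg: "0 \<le> log 2 (real (N n) / 2)"
        by simp
      have "real (2 ^ K n) = 2 powr real (K n)"
        by (simp add: powr_realpow)
      also have "\<dots> \<le> 2 powr log 2 (real (N n) / 2)"
        using log_nonneg unfolding K_def by (intro powr_mono) linarith+
      also have "\<dots> = real (N n) / 2"
        using N2 by simp
      finally have "real (2 * 2 ^ K n) \<le> real (N n)"
        by simp
      then have "2 * 2 ^ K n \<le> N n"
        by (simp only: of_nat_le_iff)
      then have K: "K n + 2 ^ K n < n div m n"
        using less_exp[of "K n"] unfolding N_def by linarith

      have "\<rho> ^ k n = exp (- (real (k n) * L))"
        by (simp add: \<rho>_exp flip: exp_of_nat_mult)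
      also have "\<dots> \<le> exp (- (2 * ln (real n) + ln (ln (real n))))"
        using elim by simp
      also have "\<dots> = 1 / (real n ^ 2 * ln (real n))"
        using n_pos ln_pos by (simp only: exp_minus exp_add exp_double exp_ln inverse_eq_divide)
      finally have "real n ^ 2 * \<rho> ^ k n \<le> real n ^ 2 * (1 / (real n ^ 2 * ln (real n)))"
        by (intro mult_left_mono) auto
      then have err1: "real n ^ 2 * \<rho> ^ k n \<le> 1 / ln (real n)"
        using n_pos by simp
      have "(1 - q) ^ (m n - 2) \<le> exp (- q) ^ (m n - 2)"
        using q exp_ge_add_one_self[of "- q"] by (intro power_mono) auto
      also have "\<dots> = exp (- q * real (m n - 2))"
        by (simp add: mult.commute flip: exp_of_nat_mult)
      also have "\<dots> \<le> exp (- q * ((ln (real n))\<^sup>2 - 2))"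
        using q m_bounds(1)[of n] by simp
      finally have err2: "real n ^ 3 * (1 - q) ^ (m n - 2) \<le>
          real n ^ 3 * exp (- q * ((ln (real n))\<^sup>2 - 2))"
        by (intro mult_left_mono) auto

      have lower: "(1 + \<delta> n) * log 2 (real n) \<le> real (K n) + 1"
      proof -
        have "(1 + \<delta> n) * log 2 (real n) = log 2 (real (N n) / 2)"
          using ln_pos by (simp add: \<delta>_def log_def)
        also have "\<dots> \<le> real (K n) + 1"
          unfolding K_def by linarith
        finally show ?thesis .
      qed
      have upper: "(2 + \<epsilon> n) * (ln (real n) / ln (1 / \<rho>)) = real (k n)"
        using L ln_pos by (simp add: \<epsilon>_def flip: L_def)
      have "1 - err n \<le> 1 - (real n ^ 2 * \<rho> ^ k n + real n ^ 3 * (1 - q) ^ (m n - 2))"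
        unfolding err_def using err1 err2 by linarith
      also have "\<dots> \<le> measure_pmf.prob (random_tournament n p)
          {G. K n < localization_number G \<and> localization_number G \<le> k n}"
        unfolding \<rho>_def q_def
        by (rule localization_number_random_tournament[OF p k k_le m K])
      also have "\<dots> \<le> ?P n"
        using lower unfolding upper by (intro measure_pmf.finite_measure_mono) auto
      finally show ?case .
    qed
  qed
  ultimately show ?thesis
    by blast
qed

theorem theorem15:
  shows "(\<forall>p::real. 0 < p \<longrightarrow> p < 1 \<longrightarrow>
            (let \<rho> = p\<^sup>2 + (1 - p)\<^sup>2 in
              \<exists>\<delta> \<epsilon> :: nat \<Rightarrow> real. \<delta> \<longlonglongrightarrow> 0 \<and> \<epsilon> \<longlonglongrightarrow> 0 \<and>
                (\<lambda>n. measure_pmf.prob (random_tournament n p)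
                   {G. (1 + \<delta> n) * log 2 (real n) \<le> real (localization_number G) \<and>
                       real (localization_number G) \<le> (2 + \<epsilon> n) * (ln (real n) / ln (1 / \<rho>))})
                \<longlonglongrightarrow> 1)) \<and>
         (\<exists>\<delta> \<epsilon> :: nat \<Rightarrow> real. \<delta> \<longlonglongrightarrow> 0 \<and> \<epsilon> \<longlonglongrightarrow> 0 \<and>
            (\<lambda>n. real (card {G \<in> tournaments n.
                       (1 + \<delta> n) * log 2 (real n) \<le> real (localization_number G) \<and>
                       real (localization_number G) \<le> (2 + \<epsilon> n) * log 2 (real n)})
                 / real (card (tournaments n)))
            \<longlonglongrightarrow> 1)"
proof (intro conjI allI impI)
  fix p :: real
  assume "0 < p" "p < 1"
  then show "let \<rho> = p\<^sup>2 + (1 - p)\<^sup>2 in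
              \<exists>\<delta> \<epsilon> :: nat \<Rightarrow> real. \<delta> \<longlonglongrightarrow> 0 \<and> \<epsilon> \<longlonglongrightarrow> 0 \<and>
                (\<lambda>n. measure_pmf.prob (random_tournament n p)
                   {G. (1 + \<delta> n) * log 2 (real n) \<le> real (localization_number G) \<and>
                       real (localization_number G) \<le> (2 + \<epsilon> n) * (ln (real n) / ln (1 / \<rho>))})
                \<longlonglongrightarrow> 1"
    unfolding Let_def by (rule localization_number_aas)
next
  have half: "(1 / 2)\<^sup>2 + (1 - 1 / 2)\<^sup>2 = (1 / 2 :: real)"
    by (simp add: power2_eq_square)
  show "\<exists>\<delta> \<epsilon> :: nat \<Rightarrow> real. \<delta> \<longlonglongrightarrow> 0 \<and> \<epsilon> \<longlonglongrightarrow> 0 \<and>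
            (\<lambda>n. real (card {G \<in> tournaments n.
                       (1 + \<delta> n) * log 2 (real n) \<le> real (localization_number G) \<and>
                       real (localization_number G) \<le> (2 + \<epsilon> n) * log 2 (real n)})
                 / real (card (tournaments n)))
            \<longlonglongrightarrow> 1"
    using localization_number_aas[of "1 / 2"]
    unfolding half prob_random_tournament_half by (simp add: log_def)
qed

end
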